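(* Let $X$ be a separable Banach space, let $\alpha\in(0,1]$, let $\{S(t)\}_{t\ge0}\subset\mathcal L(X)$ be a $C_0$--$\alpha$--semigroup, and let $\{U(s)\}_{s\ge0}$ be the associated classical $C_0$-semigroup $U(s)=S\bigl((\alpha s)^{1/\alpha}\bigr)$, $s\ge0$, so that $S(t)=U(t^\alpha/\alpha)$ for all $t\ge0$. Then $$X_0^\alpha=X_0,\qquad X_\infty^\alpha=X_\infty,\qquad X_p^\alpha=X_p,$$ where $X_0^\alpha,X_\infty^\alpha,X_p^\alpha$ are the dynamical sets associated with $\{S(t)\}_{t\ge0}$ and $X_0,X_\infty,X_p$ are the corresponding sets associated with $\{U(s)\}_{s\ge0}$. Consequently, $\{S(t)\}_{t\ge0}$ is $\alpha$-hypercyclic (resp. $\alpha$-chaotic) if and only if $\{U(s)\}_{s\ge0}$ is hypercyclic (resp. chaotic).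
   Context: $\mathcal L(X)$ is the space of bounded linear operators on $X$. An $\alpha$-semigroup on $X$ is a family $\{S(t)\}_{t\ge0}\subset\mathcal L(X)$ with $S(0)=\mathrm{Id}$ and $S\bigl((r+q)^{1/\alpha}\bigr)=S\bigl(r^{1/\alpha}\bigr)S\bigl(q^{1/\alpha}\bigr)$ for all $r,q\ge0$. It is a $C_0$--$\alpha$--semigroup if moreover $\lim_{t\to0^+}S(t)x=x$ for every $x\in X$. For $\{S(t)\}_{t\ge0}$ define $X_0^\alpha=\{x\in X:\ \lim_{t\to\infty}S(t)x=0\}$; $X_\infty^\alpha=\{x\in X:\ \forall\varepsilon>0\ \exists y\in X,\ t>0\text{ with }\|y\|<\varepsilon\text{ and }\|S(t)y-x\|<\varepsilon\}$; $X_p^\alpha=\{x\in X:\ \exists t>0\text{ such that }S(t)x=x\}$ (the $\alpha$-periodic points). The sets $X_0,X_\infty,X_p$ are defined by the same formulas with $\{U(s)\}_{s\ge0}$ in place of $\{S(t)\}_{t\ge0}$. $\{S(t)\}_{t\ge0}$ is $\alpha$-hypercyclic if there exists $x\in X$ such that the orbit $\{S(t)x:\ t\ge0\}$ is dense in $X$. It is $\alpha$-chaotic if it is $\alpha$-hypercyclic and $X_p^\alpha$ is dense in $X$. Likewise, $\{U(s)\}_{s\ge0}$ is hypercyclic if some orbit $\{U(s)x:\ s\ge0\}$ is dense in $X$, and chaotic if it is hypercyclic and $X_p$ is dense in $X$. *)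

theory Defs
  imports "HOL-Analysis.Analysis"
begin

text \<open>
  A family indexed by \<open>t \<ge> 0\<close> is a total function on \<^typ>\<open>real\<close>; every definition below
  looks only at its values on \<open>t \<ge> 0\<close>. Note that \<open>0 powr (1/\<alpha>) = 0\<close>, as it should be.
\<close>

definition alpha_semigroup ::
    "real \<Rightarrow> (real \<Rightarrow> 'a::real_normed_vector \<Rightarrow>\<^sub>L 'a) \<Rightarrow> bool" where
  "alpha_semigroup \<alpha> S \<longleftrightarrow>
     S 0 = id_blinfun \<and>
     (\<forall>r\<ge>0. \<forall>q\<ge>0. S ((r + q) powr (1/\<alpha>)) = S (r powr (1/\<alpha>)) o\<^sub>L S (q powr (1/\<alpha>)))"

definition C0_alpha_semigroup ::
    "real \<Rightarrow> (real \<Rightarrow> 'a::real_normed_vector \<Rightarrow>\<^sub>L 'a) \<Rightarrow> bool" where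
  "C0_alpha_semigroup \<alpha> S \<longleftrightarrow>
     alpha_semigroup \<alpha> S \<and> (\<forall>x. ((\<lambda>t. S t x) \<longlongrightarrow> x) (at_right 0))"

definition C0_semigroup :: "(real \<Rightarrow> 'a::real_normed_vector \<Rightarrow>\<^sub>L 'a) \<Rightarrow> bool" where
  "C0_semigroup U \<longleftrightarrow>
     U 0 = id_blinfun \<and>
     (\<forall>r\<ge>0. \<forall>s\<ge>0. U (r + s) = U r o\<^sub>L U s) \<and>
     (\<forall>x. ((\<lambda>s. U s x) \<longlongrightarrow> x) (at_right 0))"

text \<open>
  The dynamical sets, hypercyclicity and chaos are given by formulas in which \<open>\<alpha>\<close> does not
  occur. The same definitions therefore yield the \<open>\<alpha>\<close>-notions when applied to an
  \<open>\<alpha>\<close>-semigroup and the classical ones when applied to a classical semigroup.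
\<close>

definition decay_set :: "(real \<Rightarrow> 'a::real_normed_vector \<Rightarrow>\<^sub>L 'a) \<Rightarrow> 'a set" where
  "decay_set T = {x. ((\<lambda>t. T t x) \<longlongrightarrow> 0) at_top}"

definition blowup_set :: "(real \<Rightarrow> 'a::real_normed_vector \<Rightarrow>\<^sub>L 'a) \<Rightarrow> 'a set" where
  "blowup_set T = {x. \<forall>\<epsilon>>0. \<exists>y. \<exists>t>0. norm y < \<epsilon> \<and> norm (T t y - x) < \<epsilon>}"

definition periodic_points :: "(real \<Rightarrow> 'a::real_normed_vector \<Rightarrow>\<^sub>L 'a) \<Rightarrow> 'a set" where
  "periodic_points T = {x. \<exists>t>0. T t x = x}"

definition hypercyclic :: "(real \<Rightarrow> 'a::real_normed_vector \<Rightarrow>\<^sub>L 'a) \<Rightarrow> bool" where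
  "hypercyclic T \<longleftrightarrow> (\<exists>x. closure {T t x |t. t \<ge> 0} = UNIV)"

definition chaotic :: "(real \<Rightarrow> 'a::real_normed_vector \<Rightarrow>\<^sub>L 'a) \<Rightarrow> bool" where
  "chaotic T \<longleftrightarrow> hypercyclic T \<and> closure (periodic_points T) = UNIV"

end

theory Submission
  imports Defs "HOL-Real_Asymp.Real_Asymp"
begin

text \<open>The families \<open>S\<close> and \<open>U\<close> differ only by a change of clock: t
  \<mapsto> t^\<alpha>/\<alpha> and its inverse s \<mapsto> (\<alpha> s)^(1/\<alpha>) are increasing
  bijections of the half-line that fix 0 and tend to infinity. Every notion involved sees time only
  through a limit at infinity or through the existence of a suitable time, so it survives such a
  change. Each \<open>_reparam\<close> lemma gives one direction, for any clock \<open>g\<close>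
  with \<open>V t = T (g t)\<close>; applying it to both clocks gives equality.\<close>

text \<open>A limit at infinity passes to values sampled along \<open>g\<close>. The inclusion thus
  runs from \<open>T\<close> to \<open>V\<close>, whereas a witness time for \<open>V\<close> is
  carried to one for \<open>T\<close> in the lemmas below.\<close>

lemma decay_set_reparam:
  assumes "\<And>t. t > 0 \<Longrightarrow> V t = T (g t)" and "filterlim g at_top at_top"
  shows "decay_set T \<subseteq> decay_set V"
proof
  fix x assume "x \<in> decay_set T"
  then have "((\<lambda>t. T (g t) x) \<longlongrightarrow> 0) at_top"
    using assms(2) by (auto simp: decay_set_def intro: filterlim_compose)
  moreover have "\<forall>\<^sub>F t in at_top. T (g t) x = V t x"
    using eventually_gt_at_top[of 0] by eventually_elim (simp add: assms(1))
  ultimately show "x \<in> decay_set V"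
    unfolding decay_set_def by (auto intro: Lim_transform_eventually)
qed

lemma blowup_set_reparam:
  assumes "\<And>t. t > 0 \<Longrightarrow> g t > 0 \<and> V t = T (g t)"
  shows "blowup_set V \<subseteq> blowup_set T"
proof
  fix x assume x: "x \<in> blowup_set V"
  show "x \<in> blowup_set T"
    unfolding blowup_set_def
  proof (intro CollectI allI impI)
    fix \<epsilon> :: real assume "\<epsilon> > 0"
    then obtain y t where "t > 0" "norm y < \<epsilon>" "norm (V t y - x) < \<epsilon>"
      using x by (auto simp: blowup_set_def)
    then show "\<exists>y. \<exists>t>0. norm y < \<epsilon> \<and> norm (T t y - x) < \<epsilon>"
      using assms[of t] by (intro exI[of _ y] exI[of _ "g t"]) simp
  qed
qed

lemma periodic_points_reparam:
  assumes "\<And>t. t > 0 \<Longrightarrow> g t > 0 \<and> V t = T (g t)"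
  shows "periodic_points V \<subseteq> periodic_points T"
  using assms by (force simp: periodic_points_def)

text \<open>For each x the orbit under \<open>V\<close> lies inside the orbit under
  \<open>T\<close>, so the same vector works.\<close>

lemma hypercyclic_reparam:
  assumes "\<And>t. t \<ge> 0 \<Longrightarrow> g t \<ge> 0 \<and> V t = T (g t)" and "hypercyclic V"
  shows "hypercyclic T"
proof -
  obtain x where x: "closure {V t x |t. t \<ge> 0} = UNIV"
    using assms(2) by (auto simp: hypercyclic_def)
  have "{V t x |t. t \<ge> 0} \<subseteq> {T t x |t. t \<ge> 0}"
    using assms(1) by (auto 0 3)
  then have "closure {T t x |t. t \<ge> 0} = UNIV"
    using x closure_mono by blast
  then show ?thesis
    by (auto simp: hypercyclic_def)
qed

theorem lemma2:
  fixes S U :: "real \<Rightarrow> 'a::banach \<Rightarrow>\<^sub>L 'a" and \<alpha> :: real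
  assumes "separable_space (euclidean :: 'a topology)"
    and "0 < \<alpha>" and "\<alpha> \<le> 1"
    and "C0_alpha_semigroup \<alpha> S"
    and "\<And>s. s \<ge> 0 \<Longrightarrow> U s = S ((\<alpha> * s) powr (1/\<alpha>))"
  shows "C0_semigroup U \<and>
    (\<forall>t\<ge>0. S t = U (t powr \<alpha> / \<alpha>)) \<and>
    decay_set S = decay_set U \<and>
    blowup_set S = blowup_set U \<and>
    periodic_points S = periodic_points U \<and>
    (hypercyclic S \<longleftrightarrow> hypercyclic U) \<and>
    (chaotic S \<longleftrightarrow> chaotic U)"
proof -
  let ?f = "\<lambda>t. t powr \<alpha> / \<alpha>" and ?g = "\<lambda>s. (\<alpha> * s) powr (1/\<alpha>)"
  \<comment> \<open>This is \<open>?g (?f t) = t\<close>, valid at t = 0 too because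
    \<open>0 powr \<alpha> = 0\<close>.\<close>
  have S_U: "S t = U (?f t)" if "t \<ge> 0" for t
    using that assms(2) by (simp add: assms(5) powr_powr)
  have S0: "S 0 = id_blinfun"
    and S_add: "\<And>r q. r \<ge> 0 \<Longrightarrow> q \<ge> 0 \<Longrightarrow>
      S ((r + q) powr (1/\<alpha>)) = S (r powr (1/\<alpha>)) o\<^sub>L S (q powr (1/\<alpha>))"
    and S_lim: "\<And>x. ((\<lambda>t. S t x) \<longlongrightarrow> x) (at_right 0)"
    using assms(4) by (auto simp: C0_alpha_semigroup_def alpha_semigroup_def)
  have f_top: "filterlim ?f at_top at_top" and g_top: "filterlim ?g at_top at_top"
    and g_0: "filterlim ?g (at_right 0) (at_right 0)"
    using assms(2) by real_asymp+
  have "((\<lambda>s. U s x) \<longlongrightarrow> x) (at_right 0)" for x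
  proof (rule Lim_transform_eventually)
    show "((\<lambda>s. S (?g s) x) \<longlongrightarrow> x) (at_right 0)"
      by (rule filterlim_compose[OF S_lim g_0])
    show "\<forall>\<^sub>F s in at_right 0. S (?g s) x = U s x"
      using eventually_at_right_less[of 0] by eventually_elim (simp add: assms(5))
  qed
  \<comment> \<open>Since \<alpha>(r + s) = \<alpha> r + \<alpha> s, the semigroup law for
    \<open>U\<close> is \<open>S_add\<close> at \<alpha> r and \<alpha> s.\<close>
  then have C0: "C0_semigroup U"
    using assms(2) S0 S_add by (simp add: C0_semigroup_def assms(5) distrib_left)
  \<comment> \<open>Strict positivity must be kept for the blow-up and periodic sets, which exclude
    time 0; orbits include it, hence the weak versions \<open>f0\<close> and
    \<open>g0\<close>.\<close>
  have f: "t > 0 \<Longrightarrow> ?f t > 0 \<and> S t = U (?f t)" for t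
    using assms(2) S_U[of t] by simp
  have g: "s > 0 \<Longrightarrow> ?g s > 0 \<and> U s = S (?g s)" for s
    using assms(2) assms(5)[of s] by simp
  have f0: "t \<ge> 0 \<Longrightarrow> ?f t \<ge> 0 \<and> S t = U (?f t)" for t
    using assms(2) S_U[of t] by simp
  have g0: "s \<ge> 0 \<Longrightarrow> ?g s \<ge> 0 \<and> U s = S (?g s)" for s
    using assms(5)[of s] by simp
  have decay: "decay_set S = decay_set U"
    using decay_set_reparam[of S U ?f] decay_set_reparam[of U S ?g] f g f_top g_top by blast
  have blowup: "blowup_set S = blowup_set U"
    using blowup_set_reparam[of ?f S U] blowup_set_reparam[of ?g U S] f g by blast
  have periodic: "periodic_points S = periodic_points U"
    using periodic_points_reparam[of ?f S U] periodic_points_reparam[of ?g U S] f g by blast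
  have "hypercyclic S \<longleftrightarrow> hypercyclic U"
    using hypercyclic_reparam[of ?f S U] hypercyclic_reparam[of ?g U S] f0 g0 by blast
  then show ?thesis
    using C0 S_U decay blowup periodic by (simp add: chaotic_def)
qed

end
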